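(* Let $n\in\mathbb{N}$. The centraliser of $UVP_n$ in $UVB_n$, namely $C_{UVB_n}(UVP_n)=\{g\in UVB_n \mid gp=pg \text{ for every } p\in UVP_n\}$, is trivial.
   Context: The unrestricted virtual braid group $UVB_n$ is the group with generators $\sigma_1,\dots,\sigma_{n-1},\rho_1,\dots,\rho_{n-1}$ and relations: $\sigma_i\sigma_{i+1}\sigma_i=\sigma_{i+1}\sigma_i\sigma_{i+1}$ ($1\le i\le n-2$); $\sigma_i\sigma_j=\sigma_j\sigma_i$ ($|i-j|>1$); $\rho_i\rho_{i+1}\rho_i=\rho_{i+1}\rho_i\rho_{i+1}$ ($1\le i\le n-2$); $\rho_i\rho_j=\rho_j\rho_i$ ($|i-j|>1$); $\rho_i^2=1$ ($1\le i\le n-1$); $\sigma_i\rho_j=\rho_j\sigma_i$ ($|i-j|>1$); $\sigma_i\rho_{i+1}\rho_i=\rho_{i+1}\rho_i\sigma_{i+1}$ ($1\le i\le n-2$); $\rho_i\sigma_{i+1}\sigma_i=\sigma_{i+1}\sigma_i\rho_{i+1}$ ($1\le i\le n-2$); $\rho_{i+1}\sigma_i\sigma_{i+1}=\sigma_i\sigma_{i+1}\rho_i$ ($1\le i\le n-2$). The unrestricted virtual pure braid group $UVP_n$ is the kernel of the homomorphism $\phi:UVB_n\to S_n$ with $\phi(\sigma_i)=\phi(\rho_i)=(i,i+1)$ for $1\le i\le n-1$. *)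

theory Defs
  imports "HOL-Algebra.Sym_Groups"
begin

section \<open>Groups given by generators and relations\<close>

text \<open>
  A letter \<open>(x, True)\<close> stands for the generator \<open>x\<close>, and \<open>(x, False)\<close> for its formal inverse.
  A relation \<open>r = s\<close> is given as the pair of words \<open>(r, s)\<close>.
\<close>

type_synonym 'g word = "('g \<times> bool) list"

definition words :: "'g set \<Rightarrow> 'g word set"
  where "words S = lists (S \<times> UNIV)"

inductive word_equiv :: "'g set \<Rightarrow> ('g word \<times> 'g word) set \<Rightarrow> 'g word \<Rightarrow> 'g word \<Rightarrow> bool"
  for S :: "'g set" and R :: "('g word \<times> 'g word) set"
where
  refl: "w \<in> words S \<Longrightarrow> word_equiv S R w w"
| sym: "word_equiv S R v w \<Longrightarrow> word_equiv S R w v"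
| trans: "word_equiv S R u v \<Longrightarrow> word_equiv S R v w \<Longrightarrow> word_equiv S R u w"
| cancel: "u \<in> words S \<Longrightarrow> v \<in> words S \<Longrightarrow> x \<in> S
    \<Longrightarrow> word_equiv S R (u @ [(x, b), (x, \<not> b)] @ v) (u @ v)"
| relator: "u \<in> words S \<Longrightarrow> v \<in> words S \<Longrightarrow> r \<in> words S \<Longrightarrow> s \<in> words S \<Longrightarrow> (r, s) \<in> R
    \<Longrightarrow> word_equiv S R (u @ r @ v) (u @ s @ v)"

definition word_rel :: "'g set \<Rightarrow> ('g word \<times> 'g word) set \<Rightarrow> ('g word \<times> 'g word) set"
  where "word_rel S R = {(v, w). word_equiv S R v w}"

definition presented_group :: "'g set \<Rightarrow> ('g word \<times> 'g word) set \<Rightarrow> 'g word set monoid"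
  where "presented_group S R =
    \<lparr> carrier = words S // word_rel S R,
      mult = (\<lambda>A B. \<Union>v\<in>A. \<Union>w\<in>B. word_rel S R `` {v @ w}),
      one = word_rel S R `` {[]} \<rparr>"

lemma words_Nil [simp]: "[] \<in> words S"
  by (simp add: words_def)

lemma words_append [simp]: "v @ w \<in> words S \<longleftrightarrow> v \<in> words S \<and> w \<in> words S"
  by (auto simp: words_def)

lemma words_Cons [simp]: "(x, b) # w \<in> words S \<longleftrightarrow> x \<in> S \<and> w \<in> words S"
  by (auto simp: words_def)

lemma word_equiv_words: "word_equiv S R v w \<Longrightarrow> v \<in> words S \<and> w \<in> words S"
  by (induction rule: word_equiv.induct) auto

lemma equiv_word_rel: "equiv (words S) (word_rel S R)"
  unfolding word_rel_def
  by (intro equivI refl_onI symI transI)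
     (auto dest: word_equiv_words intro: word_equiv.intros)

lemma word_equiv_append_left:
  assumes "word_equiv S R v w" "u \<in> words S"
  shows "word_equiv S R (u @ v) (u @ w)"
  using assms
proof (induction rule: word_equiv.induct)
  case (cancel u' v x b)
  then show ?case using word_equiv.cancel[of "u @ u'" S v x R b] by simp
next
  case (relator u' v r s)
  then show ?case using word_equiv.relator[of "u @ u'" S v r s R] by simp
qed (auto intro: word_equiv.refl word_equiv.sym word_equiv.trans)

lemma word_equiv_append_right:
  assumes "word_equiv S R v w" "u \<in> words S"
  shows "word_equiv S R (v @ u) (w @ u)"
  using assms
proof (induction rule: word_equiv.induct)
  case (cancel u' v x b)
  then show ?case using word_equiv.cancel[of u' S "v @ u" x R b] by simp
next
  case (relator u' v r s)
  then show ?case using word_equiv.relator[of u' S "v @ u" r s R] by simp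
qed (auto intro: word_equiv.refl word_equiv.sym word_equiv.trans)

lemma word_equiv_append:
  "word_equiv S R v v' \<Longrightarrow> word_equiv S R w w' \<Longrightarrow> word_equiv S R (v @ w) (v' @ w')"
  by (meson word_equiv.trans word_equiv_append_left word_equiv_append_right word_equiv_words)

lemma word_rel_congruent2:
  "congruent2 (word_rel S R) (word_rel S R) (\<lambda>v w. word_rel S R `` {v @ w})"
proof (rule congruent2I')
  fix v v' w w'
  assume "(v, v') \<in> word_rel S R" "(w, w') \<in> word_rel S R"
  then have "(v @ w, v' @ w') \<in> word_rel S R"
    by (auto simp: word_rel_def intro: word_equiv_append)
  then show "word_rel S R `` {v @ w} = word_rel S R `` {v' @ w'}"
    by (rule equiv_class_eq[OF equiv_word_rel])
qed

lemma presented_group_mult_class: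
  assumes "v \<in> words S" "w \<in> words S"
  shows "word_rel S R `` {v} \<otimes>\<^bsub>presented_group S R\<^esub> word_rel S R `` {w} = word_rel S R `` {v @ w}"
  using UN_equiv_class2[OF equiv_word_rel equiv_word_rel word_rel_congruent2 assms]
  by (simp add: presented_group_def)

lemma presented_group_classE:
  assumes "A \<in> carrier (presented_group S R)"
  obtains w where "w \<in> words S" "A = word_rel S R `` {w}"
  using assms by (auto simp: presented_group_def elim: quotientE)

lemma presented_group_class_in_carrier:
  "w \<in> words S \<Longrightarrow> word_rel S R `` {w} \<in> carrier (presented_group S R)"
  by (simp add: presented_group_def quotientI)

lemma presented_group_one: "\<one>\<^bsub>presented_group S R\<^esub> = word_rel S R `` {[]}"
  by (simp add: presented_group_def)

lemma word_left_inverse: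
  "w \<in> words S \<Longrightarrow> \<exists>v\<in>words S. word_equiv S R (v @ w) []"
proof (induction w)
  case Nil
  then show ?case by (auto intro!: bexI[of _ "[]"] word_equiv.refl)
next
  case (Cons a w)
  obtain x b where a: "a = (x, b)" by force
  with Cons obtain v where v: "v \<in> words S" "word_equiv S R (v @ w) []" by auto
  have "word_equiv S R (v @ [(x, \<not> b), (x, \<not> \<not> b)] @ w) (v @ w)"
    using v Cons.prems a by (intro word_equiv.cancel) auto
  with v have "word_equiv S R ((v @ [(x, \<not> b)]) @ a # w) []"
    using a by (auto intro: word_equiv.trans)
  moreover have "v @ [(x, \<not> b)] \<in> words S"
    using v Cons.prems a by auto
  ultimately show ?case by blast
qed

lemma group_presented_group: "group (presented_group S R)"
proof (rule groupI)
  fix A B assume "A \<in> carrier (presented_group S R)" "B \<in> carrier (presented_group S R)"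
  then show "A \<otimes>\<^bsub>presented_group S R\<^esub> B \<in> carrier (presented_group S R)"
    by (elim presented_group_classE)
       (simp add: presented_group_mult_class presented_group_class_in_carrier)
next
  show "\<one>\<^bsub>presented_group S R\<^esub> \<in> carrier (presented_group S R)"
    by (simp add: presented_group_one presented_group_class_in_carrier)
next
  fix A B C
  assume "A \<in> carrier (presented_group S R)" "B \<in> carrier (presented_group S R)"
    "C \<in> carrier (presented_group S R)"
  then show "A \<otimes>\<^bsub>presented_group S R\<^esub> B \<otimes>\<^bsub>presented_group S R\<^esub> C
    = A \<otimes>\<^bsub>presented_group S R\<^esub> (B \<otimes>\<^bsub>presented_group S R\<^esub> C)"
    by (elim presented_group_classE) (simp add: presented_group_mult_class)
next
  fix A assume "A \<in> carrier (presented_group S R)"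
  then show "\<one>\<^bsub>presented_group S R\<^esub> \<otimes>\<^bsub>presented_group S R\<^esub> A = A"
    by (elim presented_group_classE) (simp add: presented_group_one presented_group_mult_class)
next
  fix A assume "A \<in> carrier (presented_group S R)"
  then obtain w where w: "w \<in> words S" "A = word_rel S R `` {w}"
    by (rule presented_group_classE)
  obtain v where v: "v \<in> words S" "word_equiv S R (v @ w) []"
    using word_left_inverse[OF w(1)] by blast
  then have "word_rel S R `` {v @ w} = word_rel S R `` {[]}"
    by (intro equiv_class_eq[OF equiv_word_rel]) (simp add: word_rel_def)
  with v w show "\<exists>B\<in>carrier (presented_group S R). B \<otimes>\<^bsub>presented_group S R\<^esub> A = \<one>\<^bsub>presented_group S R\<^esub>"
    by (intro bexI[of _ "word_rel S R `` {v}"])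
       (simp_all add: presented_group_one presented_group_mult_class presented_group_class_in_carrier)
qed

definition centraliser :: "('a, 'b) monoid_scheme \<Rightarrow> 'a set \<Rightarrow> 'a set"
  where "centraliser G H = {g \<in> carrier G. \<forall>p\<in>H. g \<otimes>\<^bsub>G\<^esub> p = p \<otimes>\<^bsub>G\<^esub> g}"


section \<open>Unrestricted virtual braid groups\<close>

datatype uvb_gen = Sigma_gen nat | Rho_gen nat

definition uvb_gens :: "nat \<Rightarrow> uvb_gen set"
  where "uvb_gens n = Sigma_gen ` {i. 1 \<le> i \<and> i < n} \<union> Rho_gen ` {i. 1 \<le> i \<and> i < n}"

abbreviation sg :: "nat \<Rightarrow> uvb_gen word"
  where "sg i \<equiv> [(Sigma_gen i, True)]"

abbreviation rh :: "nat \<Rightarrow> uvb_gen word"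
  where "rh i \<equiv> [(Rho_gen i, True)]"

text \<open>
  On natural numbers, \<open>\<bar>i - j\<bar> > 1\<close> is expressed as \<open>i + 1 < j \<or> j + 1 < i\<close>, and
  \<open>1 \<le> i \<le> n - 2\<close> as \<open>1 \<le> i \<and> i + 1 < n\<close>.
\<close>

definition uvb_rels :: "nat \<Rightarrow> (uvb_gen word \<times> uvb_gen word) set"
  where "uvb_rels n =
      {(sg i @ sg (i+1) @ sg i, sg (i+1) @ sg i @ sg (i+1)) | i. 1 \<le> i \<and> i + 1 < n}
    \<union> {(sg i @ sg j, sg j @ sg i) | i j. 1 \<le> i \<and> i < n \<and> 1 \<le> j \<and> j < n \<and> (i + 1 < j \<or> j + 1 < i)}
    \<union> {(rh i @ rh (i+1) @ rh i, rh (i+1) @ rh i @ rh (i+1)) | i. 1 \<le> i \<and> i + 1 < n}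
    \<union> {(rh i @ rh j, rh j @ rh i) | i j. 1 \<le> i \<and> i < n \<and> 1 \<le> j \<and> j < n \<and> (i + 1 < j \<or> j + 1 < i)}
    \<union> {(rh i @ rh i, []) | i. 1 \<le> i \<and> i < n}
    \<union> {(sg i @ rh j, rh j @ sg i) | i j. 1 \<le> i \<and> i < n \<and> 1 \<le> j \<and> j < n \<and> (i + 1 < j \<or> j + 1 < i)}
    \<union> {(sg i @ rh (i+1) @ rh i, rh (i+1) @ rh i @ sg (i+1)) | i. 1 \<le> i \<and> i + 1 < n}
    \<union> {(rh i @ sg (i+1) @ sg i, sg (i+1) @ sg i @ rh (i+1)) | i. 1 \<le> i \<and> i + 1 < n}
    \<union> {(rh (i+1) @ sg i @ sg (i+1), sg i @ sg (i+1) @ rh i) | i. 1 \<le> i \<and> i + 1 < n}"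

definition UVB :: "nat \<Rightarrow> uvb_gen word set monoid"
  where "UVB n = presented_group (uvb_gens n) (uvb_rels n)"

definition uvb_class :: "nat \<Rightarrow> uvb_gen word \<Rightarrow> uvb_gen word set"
  where "uvb_class n w = word_rel (uvb_gens n) (uvb_rels n) `` {w}"

lemma group_UVB: "group (UVB n)"
  by (simp add: UVB_def group_presented_group)

text \<open>
  A formal inverse is sent to the same permutation as its generator, transpositions being
  involutions.
\<close>

fun gen_perm :: "uvb_gen \<Rightarrow> nat \<Rightarrow> nat" where
  "gen_perm (Sigma_gen i) = transpose i (i+1)"
| "gen_perm (Rho_gen i) = transpose i (i+1)"

fun word_perm :: "uvb_gen word \<Rightarrow> nat \<Rightarrow> nat" where
  "word_perm [] = id"
| "word_perm ((x, b) # w) = gen_perm x \<circ> word_perm w"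

text \<open>
  \<open>word_perm\<close> is constant on each element of \<open>UVB n\<close>, so \<open>the_elem\<close> below picks its value.
\<close>

definition uvb_phi :: "uvb_gen word set \<Rightarrow> nat \<Rightarrow> nat"
  where "uvb_phi A = the_elem (word_perm ` A)"

definition UVP :: "nat \<Rightarrow> uvb_gen word set set"
  where "UVP n = kernel (UVB n) (sym_group n) uvb_phi"

lemma word_perm_append: "word_perm (v @ w) = word_perm v \<circ> word_perm w"
  by (induction v rule: word_perm.induct) (auto simp: comp_assoc)

lemma gen_perm_involution: "gen_perm x (gen_perm x k) = k"
  by (cases x) auto

lemma word_perm_rels:
  assumes "(r, s) \<in> uvb_rels n"
  shows "word_perm r = word_perm s"
proof -
  have "word_perm r k = word_perm s k" for k
    using assms unfolding uvb_rels_def by (auto simp: transpose_def)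
  then show ?thesis by blast
qed

lemma word_perm_equiv:
  "word_equiv S (uvb_rels n) v w \<Longrightarrow> word_perm v = word_perm w"
  by (induction rule: word_equiv.induct)
     (auto simp: word_perm_append gen_perm_involution fun_eq_iff dest: word_perm_rels)

lemma word_perm_permutes:
  "w \<in> words (uvb_gens n) \<Longrightarrow> word_perm w permutes {1..n}"
proof (induction w rule: word_perm.induct)
  case 1
  then show ?case by (simp only: word_perm.simps permutes_id)
next
  case (2 x b w)
  have "gen_perm x permutes {1..n}"
    using 2 by (auto simp: uvb_gens_def intro!: permutes_swap_id)
  moreover have "word_perm w permutes {1..n}"
    using 2 by simp
  ultimately show ?case
    unfolding word_perm.simps by (rule permutes_compose[rotated])
qed

lemma uvb_phi_class:
  assumes "w \<in> words (uvb_gens n)"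
  shows "uvb_phi (uvb_class n w) = word_perm w"
proof -
  have "word_perm ` uvb_class n w = {word_perm w}"
    using assms by (auto simp: uvb_class_def word_rel_def dest: word_perm_equiv
        intro!: rev_image_eqI[of w] word_equiv.refl)
  then show ?thesis by (simp add: uvb_phi_def)
qed

lemma uvb_phi_hom: "uvb_phi \<in> hom (UVB n) (sym_group n)"
proof (rule homI)
  fix A assume "A \<in> carrier (UVB n)"
  then obtain v where "v \<in> words (uvb_gens n)" "A = uvb_class n v"
    unfolding UVB_def uvb_class_def by (rule presented_group_classE)
  then show "uvb_phi A \<in> carrier (sym_group n)"
    using word_perm_permutes by (simp only: uvb_phi_class sym_group_carrier)
next
  fix A B assume "A \<in> carrier (UVB n)" "B \<in> carrier (UVB n)"
  then obtain v w where vw: "v \<in> words (uvb_gens n)" "A = uvb_class n v"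
      "w \<in> words (uvb_gens n)" "B = uvb_class n w"
    unfolding UVB_def uvb_class_def by (metis presented_group_classE)
  then have "A \<otimes>\<^bsub>UVB n\<^esub> B = uvb_class n (v @ w)"
    by (simp add: UVB_def uvb_class_def presented_group_mult_class)
  with vw show "uvb_phi (A \<otimes>\<^bsub>UVB n\<^esub> B) = uvb_phi A \<otimes>\<^bsub>sym_group n\<^esub> uvb_phi B"
    by (simp add: uvb_phi_class sym_group_mult word_perm_append)
qed

lemma uvb_phi_generators:
  assumes "1 \<le> i" "i < n"
  shows "uvb_phi (uvb_class n (sg i)) = transpose i (i+1)"
    and "uvb_phi (uvb_class n (rh i)) = transpose i (i+1)"
  using assms by (simp_all add: uvb_phi_class uvb_gens_def)

end

theory Submission
  imports Defs
begin

text \<open>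
  The pure group contains, for every ordered pair of distinct strands, an arrow
  \<open>\<lambda>\<^sub>p\<^sub>q\<close>: put \<open>\<lambda>\<^sub>1\<^sub>2 = \<sigma>\<^sub>1\<rho>\<^sub>1\<close> and let the subgroup generated by the
  \<open>\<rho>\<^sub>i\<close>, a copy of the symmetric group, act by conjugation. Then
  \<open>\<sigma>\<^sub>i = \<lambda>\<^sub>i\<^sub>,\<^sub>i\<^sub>+\<^sub>1\<rho>\<^sub>i\<close>, and pushing all \<open>\<rho>\<close>'s to the right turns any braid word
  into a word in the arrows followed by a word in the \<open>\<rho>\<close>'s. The braid relation for the
  \<open>\<sigma>\<close>'s and the two forbidden relations say exactly that arrows over different unordered pairs
  of strands commute, while \<open>\<lambda>\<^sub>p\<^sub>q\<close> and \<open>\<lambda>\<^sub>q\<^sub>p\<close> satisfy no relation. So the group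
  is the semidirect product of the symmetric group with a direct product of free groups of rank two,
  one for each unordered pair of strands.

  Let \<open>g\<close> centralise the pure group, with permutation \<open>\<pi>\<close>. Conjugation by \<open>g\<close> takes
  \<open>\<lambda>\<^sub>p\<^sub>q\<close> to a conjugate of the arrow from \<open>\<pi> p\<close> to \<open>\<pi> q\<close>; comparing exponent
  sums gives \<open>\<pi> p = p\<close> and \<open>\<pi> q = q\<close>, so \<open>\<pi>\<close> is the identity. Then each component of
  \<open>g\<close> commutes with both generators of a free group of rank two, hence is trivial, and
  \<open>g = 1\<close>.

  The semidirect product itself is never constructed; two halves of the isomorphism suffice. The
  invariants are well defined: the free reduction of the arrows of a word over one unordered pair
  depends only on the group element (\<open>strand_word_equiv\<close>). They are complete: a word with
  identity permutation and trivial reductions represents the unit (\<open>cls_trivial\<close>). Completeness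
  rests on three facts: the \<open>\<rho>\<close>'s generate no more than the symmetric group
  (\<open>R_faithful\<close>), the arrows are well defined (\<open>arrow_elem_rho_perm\<close>), and arrows over
  different pairs commute (\<open>arrow_elem_commute\<close>).
\<close>

section \<open>Free reduction of words\<close>

text \<open>
  Used to find, within a word, the two letters that are adjacent once the letters over other pairs of
  strands have been removed.
\<close>

lemma filter_eq_appendE:
  assumes "filter P w = u @ v"
  obtains a b where "w = a @ b" "filter P a = u" "filter P b = v"
  using assms
proof (induction w arbitrary: u thesis)
  case (Cons x w)
  show ?case
  proof (cases "P x \<and> u \<noteq> []")
    case True
    then obtain u' where "u = x # u'" "filter P w = u' @ v"
      using Cons.prems(2) by (cases u) auto
    then show ?thesis using Cons.IH[of u'] Cons.prems(1) True
      by (metis append_Cons filter.simps(2))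
  next
    case False
    show ?thesis
    proof (cases "P x")
      case True
      then show ?thesis using False Cons.prems(1)[of "[]" "x # w"] Cons.prems(2) by simp
    next
      case False
      then obtain a b where "w = a @ b" "filter P a = u" "filter P b = v"
        using Cons.IH[of u] Cons.prems(2) by auto
      then show ?thesis using False Cons.prems(1)[of "x # a" b] by simp
    qed
  qed
qed simp

definition inv_letter :: "'g \<times> bool \<Rightarrow> 'g \<times> bool"
  where "inv_letter x = (fst x, \<not> snd x)"

lemma inv_letter_inv_letter [simp]: "inv_letter (inv_letter x) = x"
  by (simp add: inv_letter_def)

fun cons_cancel :: "'g \<times> bool \<Rightarrow> 'g word \<Rightarrow> 'g word" where
  "cons_cancel x [] = [x]"
| "cons_cancel x (y # w) = (if y = inv_letter x then w else x # y # w)"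

fun free_reduce :: "'g word \<Rightarrow> 'g word" where
  "free_reduce [] = []"
| "free_reduce (x # w) = cons_cancel x (free_reduce w)"

abbreviation reduced :: "'g word \<Rightarrow> bool"
  where "reduced \<equiv> successively (\<lambda>x y. y \<noteq> inv_letter x)"

lemma reduced_cons_cancel: "reduced w \<Longrightarrow> reduced (cons_cancel x w)"
  by (cases w) (auto simp: successively_Cons)

lemma reduced_free_reduce: "reduced (free_reduce w)"
  by (induction w) (auto intro: reduced_cons_cancel)

lemma free_reduce_reduced: "reduced w \<Longrightarrow> free_reduce w = w"
  by (induction w rule: induct_list012) auto

text \<open>
  This makes every letter act as a bijection on reduced words, inverse to its inverse letter, and so
  makes free reduction invariant under insertion of cancelling pairs.
\<close>

lemma cons_cancel_inverse:
  "reduced w \<Longrightarrow> cons_cancel x (cons_cancel (inv_letter x) w) = w"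
  by (cases w; cases "tl w") (auto simp: successively_Cons)

lemma free_reduce_cancel: "free_reduce (u @ x # inv_letter x # v) = free_reduce (u @ v)"
  by (induction u) (simp_all add: cons_cancel_inverse reduced_free_reduce)

lemma free_reduce_cons_cancel_append:
  "free_reduce (cons_cancel x u @ v) = cons_cancel x (free_reduce (u @ v))"
proof (cases u)
  case (Cons y u')
  then show ?thesis
    by (cases "y = inv_letter x") (simp_all add: cons_cancel_inverse reduced_free_reduce)
qed simp

lemma free_reduce_append: "free_reduce (free_reduce u @ v) = free_reduce (u @ v)"
  by (induction u) (simp_all add: free_reduce_cons_cancel_append)

lemma length_cons_cancel: "length (cons_cancel x w) \<le> Suc (length w)"
  by (cases w) auto

lemma free_reduce_shorter: "free_reduce w = w \<or> length (free_reduce w) < length w"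
proof (induction w)
  case (Cons x w)
  show ?case
  proof (cases "free_reduce w = w")
    case True
    then show ?thesis by (cases w) auto
  next
    case False
    then show ?thesis using Cons length_cons_cancel[of x "free_reduce w"] by simp
  qed
qed simp

lemma not_reduced_split:
  "\<not> reduced w \<Longrightarrow> \<exists>u x v. w = u @ x # inv_letter x # v"
proof (induction w rule: induct_list012)
  case (3 x y zs)
  show ?case
  proof (cases "y = inv_letter x")
    case True
    then show ?thesis by (intro exI[of _ "[]"] exI[of _ x] exI[of _ zs]) simp
  next
    case False
    then obtain u z v where "y # zs = u @ z # inv_letter z # v"
      using 3 by auto
    then show ?thesis by (intro exI[of _ "x # u"] exI[of _ z] exI[of _ v]) simp
  qed
qed auto

text \<open>
  Two letters are enough to detect triviality. If the reduced form of \<open>w\<close> is non-empty, one of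
  the generators, say \<open>c\<close>, differs from the generator of its first letter. Prepending \<open>c\<close>
  then cancels nothing and gives a word longer by one, so appending \<open>c\<close> cancels nothing either;
  but the two results start with different letters.
\<close>

lemma free_reduce_central:
  assumes "a \<noteq> b"
    and "free_reduce (w @ [(a, True)]) = free_reduce ((a, True) # w)"
    and "free_reduce (w @ [(b, True)]) = free_reduce ((b, True) # w)"
  shows "free_reduce w = []"
proof (rule ccontr)
  let ?u = "free_reduce w"
  assume "?u \<noteq> []"
  then obtain y v where y: "?u = y # v" by (cases ?u) auto
  obtain c where c: "c \<noteq> fst y" "free_reduce (w @ [(c, True)]) = free_reduce ((c, True) # w)"
    using assms by metis
  then have "free_reduce ((c, True) # w) = (c, True) # ?u"
    using y by (auto simp: inv_letter_def)
  then have *: "free_reduce (?u @ [(c, True)]) = (c, True) # ?u"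
    using c(2) by (simp add: free_reduce_append)
  then have "length (free_reduce (?u @ [(c, True)])) = length (?u @ [(c, True)])"
    by simp
  then have "free_reduce (?u @ [(c, True)]) = ?u @ [(c, True)]"
    using free_reduce_shorter[of "?u @ [(c, True)]"] by linarith
  with * y c(1) show False by auto
qed

definition exponent_sum :: "'g \<Rightarrow> 'g word \<Rightarrow> int"
  where "exponent_sum a w = (\<Sum>x\<leftarrow>w. if fst x = a then if snd x then 1 else -1 else 0)"

lemma exponent_sum_simps [simp]:
  "exponent_sum a [] = 0"
  "exponent_sum a (x # w) = (if fst x = a then if snd x then 1 else -1 else 0) + exponent_sum a w"
  "exponent_sum a (u @ w) = exponent_sum a u + exponent_sum a w"
  by (simp_all add: exponent_sum_def)

lemma exponent_sum_free_reduce: "exponent_sum a (free_reduce w) = exponent_sum a w"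
proof -
  have "exponent_sum a (cons_cancel x w) = exponent_sum a (x # w)" for x w
    by (cases w) (auto simp: inv_letter_def)
  then show ?thesis by (induction w) simp_all
qed

section \<open>The arrow words of a braid word\<close>

type_synonym arrow = "nat \<times> nat"

text \<open>
  The unordered pair of strands of an arrow letter. It is the index of the free factor to which the
  letter belongs.
\<close>

definition ends :: "arrow \<times> bool \<Rightarrow> nat set"
  where "ends x = {fst (fst x), snd (fst x)}"

text \<open>
  The action of permutations of the strands on arrows, which is conjugation by the corresponding
  element of the symmetric group.
\<close>

definition relabel :: "(nat \<Rightarrow> nat) \<Rightarrow> arrow \<times> bool \<Rightarrow> arrow \<times> bool"
  where "relabel f = map_prod (map_prod f f) id"

lemma relabel_ident [simp]: "relabel (\<lambda>a. a) = (\<lambda>x. x)"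
  by (auto simp: relabel_def)

lemma relabel_id [simp]: "relabel id = (\<lambda>x. x)"
  by (auto simp: relabel_def)

lemma relabel_relabel: "relabel f (relabel g x) = relabel (\<lambda>a. f (g a)) x"
  by (cases x) (auto simp: relabel_def)

lemma relabel_Pair: "relabel f ((p, q), b) = ((f p, f q), b)"
  by (simp add: relabel_def)

lemma ends_relabel: "ends (relabel f x) = f ` ends x"
  by (simp add: ends_def relabel_def)

lemma inv_letter_relabel: "relabel f (inv_letter x) = inv_letter (relabel f x)"
  by (simp add: inv_letter_def relabel_def)

text \<open>
  The letter \<open>\<sigma>\<^sub>i\<close> is the arrow from \<open>i\<close> to \<open>i+1\<close> followed by \<open>\<rho>\<^sub>i\<close>. Its inverse is
  \<open>\<rho>\<^sub>i\<close> followed by the inverse arrow; moving \<open>\<rho>\<^sub>i\<close> to the right reverses the arrow, whence the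
  exchanged end points.
\<close>

fun gen_arrows :: "uvb_gen \<times> bool \<Rightarrow> arrow word" where
  "gen_arrows (Sigma_gen i, b) = [(if b then (i, i+1) else (i+1, i), b)]"
| "gen_arrows (Rho_gen i, b) = []"

text \<open>
  The arrows that remain when every \<open>\<rho>\<close> is moved to the right end of the word: a letter acts
  on everything to its right through its permutation.
\<close>

fun arrows :: "uvb_gen word \<Rightarrow> arrow word" where
  "arrows [] = []"
| "arrows (x # w) = gen_arrows x @ map (relabel (gen_perm (fst x))) (arrows w)"

text \<open>
  A representative of the component in the free group on the two arrows between the strands in
  \<open>D\<close>.
\<close>

definition strand_word :: "nat set \<Rightarrow> uvb_gen word \<Rightarrow> arrow word"
  where "strand_word D w = filter (\<lambda>x. ends x = D) (arrows w)"

lemma word_perm_Cons: "word_perm (x # w) = gen_perm (fst x) \<circ> word_perm w"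
  by (cases x) simp

lemma bij_word_perm: "bij (word_perm w)"
proof -
  have "bij (gen_perm x)" for x by (cases x) simp_all
  then show ?thesis by (induction w) (auto simp: word_perm_Cons intro: bij_comp simp del: id_apply)
qed

lemma arrows_append: "arrows (v @ w) = arrows v @ map (relabel (word_perm v)) (arrows w)"
  by (induction v) (simp_all add: word_perm_Cons relabel_relabel)

text \<open>
  An arrow over \<open>D\<close> in the product comes either from the first factor or, through the permutation
  of the first factor, from an arrow of the second factor over the preimage of \<open>D\<close>.
\<close>

lemma strand_word_append:
  "strand_word D (v @ w) =
    strand_word D v @ map (relabel (word_perm v)) (strand_word (inv_into UNIV (word_perm v) ` D) w)"
proof -
  have "word_perm v ` E = D \<longleftrightarrow> E = inv_into UNIV (word_perm v) ` D" for E
    using bij_word_perm[of v] by (metis bij_is_inj bij_is_surj image_f_inv_f image_inv_f_f)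
  then show ?thesis
    by (simp add: strand_word_def arrows_append filter_map o_def ends_relabel)
qed

text \<open>
  The two sides of a relation carry the same arrows, up to an exchange of arrows over different pairs
  of strands: for instance \<open>\<lambda>\<^sub>1\<^sub>2 \<lambda>\<^sub>1\<^sub>3 \<lambda>\<^sub>2\<^sub>3\<close> and
  \<open>\<lambda>\<^sub>2\<^sub>3 \<lambda>\<^sub>1\<^sub>3 \<lambda>\<^sub>1\<^sub>2\<close> for the braid relation. Over a single pair they agree
  without any reduction.
\<close>

lemma strand_word_rels:
  assumes "(r, s) \<in> uvb_rels n"
  shows "strand_word D r = strand_word D s"
  using assms unfolding uvb_rels_def
  by (auto simp: strand_word_def relabel_def ends_def transpose_def doubleton_eq_iff)

lemma strand_word_cancel:
  "strand_word D [(x, b), (x, \<not> b)] = []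
    \<or> (\<exists>y. strand_word D [(x, b), (x, \<not> b)] = [y, inv_letter y])"
  by (cases x; cases b) (auto simp: strand_word_def relabel_def ends_def inv_letter_def)

lemma strand_word_equiv:
  assumes "word_equiv S (uvb_rels n) v w"
  shows "free_reduce (strand_word D v) = free_reduce (strand_word D w)"
  using assms
proof induction
  case (cancel u v x b)
  let ?f = "relabel (word_perm u)" and ?E = "inv_into UNIV (word_perm u) ` D"
  have "word_perm [(x, b), (x, \<not> b)] = id"
    by (simp add: fun_eq_iff gen_perm_involution)
  then have "strand_word D (u @ [(x, b), (x, \<not> b)] @ v) = strand_word D u
      @ map ?f (strand_word ?E [(x, b), (x, \<not> b)]) @ map ?f (strand_word ?E v)"
    by (simp only: strand_word_append) simp
  moreover have "free_reduce (strand_word D u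
      @ map ?f (strand_word ?E [(x, b), (x, \<not> b)]) @ map ?f (strand_word ?E v))
      = free_reduce (strand_word D u @ map ?f (strand_word ?E v))"
    using strand_word_cancel[of ?E x b]
    by (auto simp: inv_letter_relabel free_reduce_cancel)
  ultimately show ?case by (simp add: strand_word_append)
next
  case (relator u v r s)
  then show ?case
    by (simp add: strand_word_append word_perm_rels strand_word_rels[of r s])
qed simp_all

section \<open>Commutation and conjugation in groups\<close>

context group
begin

lemma inv_mul_cancel [simp]:
  "g \<in> carrier G \<Longrightarrow> x \<in> carrier G \<Longrightarrow> inv g \<otimes> (g \<otimes> x) = x"
  "g \<in> carrier G \<Longrightarrow> x \<in> carrier G \<Longrightarrow> g \<otimes> (inv g \<otimes> x) = x"
  by (simp_all flip: m_assoc)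

lemma commute_inv:
  assumes "g \<otimes> h = h \<otimes> g" "g \<in> carrier G" "h \<in> carrier G"
  shows "inv g \<otimes> h = h \<otimes> inv g"
proof -
  have "inv g \<otimes> h = inv g \<otimes> (h \<otimes> g) \<otimes> inv g" using assms by (simp add: m_assoc)
  also have "\<dots> = h \<otimes> inv g" using assms by (simp flip: assms(1))
  finally show ?thesis .
qed

definition conjugate :: "'a \<Rightarrow> 'a \<Rightarrow> 'a"
  where "conjugate g x = g \<otimes> x \<otimes> inv g"

lemma conjugate_closed [simp]:
  "g \<in> carrier G \<Longrightarrow> x \<in> carrier G \<Longrightarrow> conjugate g x \<in> carrier G"
  by (simp add: conjugate_def)

lemma conjugate_one [simp]: "g \<in> carrier G \<Longrightarrow> conjugate g \<one> = \<one>"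
  by (simp add: conjugate_def)

lemma one_conjugate [simp]: "x \<in> carrier G \<Longrightarrow> conjugate \<one> x = x"
  by (simp add: conjugate_def)

lemma conjugate_mult:
  "g \<in> carrier G \<Longrightarrow> x \<in> carrier G \<Longrightarrow> y \<in> carrier G
    \<Longrightarrow> conjugate g (x \<otimes> y) = conjugate g x \<otimes> conjugate g y"
  by (simp add: conjugate_def m_assoc)

lemma conjugate_inv:
  "g \<in> carrier G \<Longrightarrow> x \<in> carrier G \<Longrightarrow> conjugate g (inv x) = inv (conjugate g x)"
  by (simp add: conjugate_def m_assoc inv_mult_group)

lemma conjugate_conjugate:
  "g \<in> carrier G \<Longrightarrow> h \<in> carrier G \<Longrightarrow> x \<in> carrier G
    \<Longrightarrow> conjugate g (conjugate h x) = conjugate (g \<otimes> h) x"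
  by (simp add: conjugate_def m_assoc inv_mult_group)

lemma conjugate_commute:
  assumes "g \<otimes> x = x \<otimes> g" "g \<in> carrier G" "x \<in> carrier G"
  shows "conjugate g x = x"
  using assms by (simp add: conjugate_def m_assoc)

text \<open>
  On three strands, with \<open>x, y\<close> for \<open>\<sigma>\<^sub>1, \<sigma>\<^sub>2\<close> and \<open>p, q\<close> for
  \<open>\<rho>\<^sub>1, \<rho>\<^sub>2\<close>, the elements \<open>a\<close>, \<open>b\<close>, \<open>c\<close> are the arrows
  \<open>\<lambda>\<^sub>1\<^sub>2\<close>, \<open>\<lambda>\<^sub>1\<^sub>3\<close>, \<open>\<lambda>\<^sub>2\<^sub>3\<close>. Each relation that mixes two
  \<open>\<sigma>\<close>'s becomes one statement about them: the forbidden relations \<open>pyx\<close> and \<open>qxy\<close>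
  say that \<open>b\<close> commutes with \<open>c\<close> and with \<open>a\<close>, and the braid relation \<open>xyx\<close>
  says that \<open>a b c = c b a\<close>, so that \<open>a\<close> and \<open>c\<close> commute once \<open>b\<close> commutes with
  both.
\<close>

lemma three_strands_commute:
  assumes carr: "x \<in> carrier G" "y \<in> carrier G" "p \<in> carrier G" "q \<in> carrier G"
    and invol: "p \<otimes> p = \<one>" "q \<otimes> q = \<one>"
    and xyx: "x \<otimes> (y \<otimes> x) = y \<otimes> (x \<otimes> y)"
    and pqp: "p \<otimes> (q \<otimes> p) = q \<otimes> (p \<otimes> q)"
    and xqp: "x \<otimes> (q \<otimes> p) = q \<otimes> (p \<otimes> y)"
    and pyx: "p \<otimes> (y \<otimes> x) = y \<otimes> (x \<otimes> q)"
    and qxy: "q \<otimes> (x \<otimes> y) = x \<otimes> (y \<otimes> p)"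
  defines "a \<equiv> x \<otimes> p" and "b \<equiv> q \<otimes> (x \<otimes> (p \<otimes> q))" and "c \<equiv> y \<otimes> q"
  shows "a \<otimes> b = b \<otimes> a" and "b \<otimes> c = c \<otimes> b" and "a \<otimes> c = c \<otimes> a"
proof -
  have canc: "p \<otimes> (p \<otimes> g) = g" "q \<otimes> (q \<otimes> g) = g" if "g \<in> carrier G" for g
    using that carr invol by (simp_all flip: m_assoc)
  have ext: "p \<otimes> (q \<otimes> (p \<otimes> g)) = q \<otimes> (p \<otimes> (q \<otimes> g))"
    "x \<otimes> (q \<otimes> (p \<otimes> g)) = q \<otimes> (p \<otimes> (y \<otimes> g))"
    "x \<otimes> (y \<otimes> (x \<otimes> g)) = y \<otimes> (x \<otimes> (y \<otimes> g))"
    "p \<otimes> (y \<otimes> (x \<otimes> g)) = y \<otimes> (x \<otimes> (q \<otimes> g))"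
    "q \<otimes> (x \<otimes> (y \<otimes> g)) = x \<otimes> (y \<otimes> (p \<otimes> g))" if "g \<in> carrier G" for g
    using that carr pqp xqp xyx pyx qxy by (simp_all flip: m_assoc)
  have pqpq: "q \<otimes> (p \<otimes> (q \<otimes> p)) = p \<otimes> q"
    using carr by (simp add: pqp canc)
  have pqx: "p \<otimes> (q \<otimes> (x \<otimes> g)) = y \<otimes> (p \<otimes> (q \<otimes> g))" if "g \<in> carrier G" for g
  proof -
    have "p \<otimes> (q \<otimes> (x \<otimes> g)) = p \<otimes> (q \<otimes> (x \<otimes> (q \<otimes> (p \<otimes> (p \<otimes> (q \<otimes> g))))))"
      using that carr by (simp add: canc)
    also have "\<dots> = y \<otimes> (p \<otimes> (q \<otimes> g))"
      using that carr ext(2)[of "p \<otimes> (q \<otimes> g)"] by (simp add: canc)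
    finally show ?thesis .
  qed
  have b: "b = p \<otimes> (y \<otimes> (q \<otimes> p))"
  proof -
    have "p \<otimes> (y \<otimes> (q \<otimes> p)) = p \<otimes> (y \<otimes> (p \<otimes> (q \<otimes> (q \<otimes> (p \<otimes> (q \<otimes> p))))))"
      using carr by (simp add: canc)
    also have "\<dots> = p \<otimes> (p \<otimes> (q \<otimes> (x \<otimes> (q \<otimes> (p \<otimes> (q \<otimes> p))))))"
      using carr by (simp add: pqx)
    also have "\<dots> = b" using carr by (simp add: b_def canc pqpq)
    finally show ?thesis by simp
  qed
  have carr': "a \<in> carrier G" "b \<in> carrier G" "c \<in> carrier G"
    using carr by (simp_all add: a_def b_def c_def)
  have cb: "c \<otimes> b = y \<otimes> (x \<otimes> (p \<otimes> q))"
    using carr by (simp add: c_def b_def m_assoc canc)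
  have "b \<otimes> c = p \<otimes> ((y \<otimes> (q \<otimes> (p \<otimes> (y \<otimes> q)))))"
    using carr by (simp add: c_def b m_assoc)
  also have "\<dots> = p \<otimes> (y \<otimes> (x \<otimes> (q \<otimes> (p \<otimes> q))))"
    using carr by (simp add: ext(2)[symmetric])
  also have "\<dots> = y \<otimes> (x \<otimes> (q \<otimes> (q \<otimes> (p \<otimes> q))))"
    using carr by (simp add: ext(4))
  also have "\<dots> = c \<otimes> b" using carr by (simp add: cb canc)
  finally show bc: "b \<otimes> c = c \<otimes> b" .
  have ab: "a \<otimes> b = x \<otimes> (y \<otimes> (q \<otimes> p))"
    using carr by (simp add: a_def b m_assoc canc)
  have "b \<otimes> a = q \<otimes> (x \<otimes> (p \<otimes> (q \<otimes> (x \<otimes> p))))"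
    using carr by (simp add: a_def b_def m_assoc)
  also have "\<dots> = q \<otimes> (x \<otimes> (y \<otimes> (p \<otimes> (q \<otimes> p))))"
    using carr by (simp add: pqx)
  also have "\<dots> = x \<otimes> (y \<otimes> (p \<otimes> (p \<otimes> (q \<otimes> p))))"
    using carr by (simp add: ext(5))
  also have "\<dots> = a \<otimes> b" using carr by (simp add: ab canc)
  finally show ab': "a \<otimes> b = b \<otimes> a" by simp
  have "a \<otimes> b \<otimes> c = x \<otimes> (y \<otimes> (q \<otimes> (p \<otimes> (y \<otimes> q))))"
    using carr by (simp add: ab c_def m_assoc)
  also have "\<dots> = x \<otimes> (y \<otimes> (x \<otimes> (q \<otimes> (p \<otimes> q))))"
    using carr by (simp add: ext(2)[symmetric])
  also have "\<dots> = y \<otimes> (x \<otimes> (y \<otimes> (p \<otimes> (q \<otimes> p))))"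
    using carr by (simp add: ext(3) pqp)
  also have "\<dots> = y \<otimes> (x \<otimes> (p \<otimes> (q \<otimes> (x \<otimes> p))))"
    using carr by (simp add: pqx)
  also have "\<dots> = c \<otimes> b \<otimes> a"
    using carr by (simp add: cb a_def m_assoc)
  finally have "a \<otimes> b \<otimes> c = c \<otimes> b \<otimes> a" .
  then have "b \<otimes> (a \<otimes> c) = b \<otimes> (c \<otimes> a)"
    using carr' by (simp only: ab' bc[symmetric] m_assoc)
  then show "a \<otimes> c = c \<otimes> a" using carr' by simp
qed

end

section \<open>Permutations as products of adjacent transpositions\<close>

abbreviation rho_word :: "nat list \<Rightarrow> uvb_gen word"
  where "rho_word is \<equiv> map (\<lambda>i. (Rho_gen i, True)) is"

abbreviation rho_perm :: "nat list \<Rightarrow> nat \<Rightarrow> nat"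
  where "rho_perm is \<equiv> word_perm (rho_word is)"

lemma rho_perm_upt: "m \<le> k \<Longrightarrow> rho_perm [m..<k] k = m"
  by (induction k rule: dec_induct) (auto simp: word_perm_append transpose_def)

lemma rho_perm_fixes: "\<forall>i\<in>set is. k < i \<Longrightarrow> rho_perm is k = k"
  by (induction "is") (auto simp: transpose_def)

lemma rho_perm_transpose_Suc:
  assumes "1 \<le> a" "a + d + 1 \<le> n"
  shows "\<exists>is. set is \<subseteq> {1..<n} \<and> rho_perm is = transpose a (a + d + 1)"
  using assms(2)
proof (induction d)
  case 0
  then show ?case using assms(1) by (intro exI[of _ "[a]"]) auto
next
  case (Suc d)
  then obtain js where js: "set js \<subseteq> {1..<n}" "rho_perm js = transpose a (a + d + 1)"
    by auto
  let ?b = "a + d + 1"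
  have "rho_perm ([?b] @ js @ [?b]) x = transpose a (?b + 1) x" for x
    using js(2) by (simp add: word_perm_append) (simp add: transpose_def)
  then have "rho_perm ([?b] @ js @ [?b]) = transpose a (a + Suc d + 1)" by (simp add: fun_eq_iff)
  moreover have "set ([?b] @ js @ [?b]) \<subseteq> {1..<n}" using js Suc.prems by auto
  ultimately show ?case by blast
qed

lemma rho_perm_transpose:
  assumes "a \<in> {1..n}" "b \<in> {1..n}"
  shows "\<exists>is. set is \<subseteq> {1..<n} \<and> rho_perm is = transpose a b"
proof -
  consider "a = b" | "a < b" | "b < a" by linarith
  then show ?thesis
  proof cases
    case 1
    then show ?thesis by (intro exI[of _ "[]"]) simp
  next
    case 2
    then obtain d where "b = a + d + 1" by (auto simp: less_iff_Suc_add)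
    with assms show ?thesis using rho_perm_transpose_Suc[of a d n] by simp
  next
    case 3
    then obtain d where "a = b + d + 1" by (auto simp: less_iff_Suc_add)
    with assms show ?thesis using rho_perm_transpose_Suc[of b d n]
      by (simp add: transpose_commute)
  qed
qed

lemma rho_perm_mem: "set is \<subseteq> {1..<n} \<Longrightarrow> rho_perm is x \<in> {1..n} \<longleftrightarrow> x \<in> {1..n}"
  by (rule permutes_in_image, rule word_perm_permutes) (force simp: words_def uvb_gens_def)

text \<open>
  Symmetric groups are highly transitive; up to four points are needed to bring two arrows into
  standard position. The induction corrects the image of one further point by a transposition that
  does not touch the images already in place.
\<close>

lemma rho_perm_transitive:
  assumes "length xs = length ys" "distinct xs" "distinct ys"
    "set xs \<subseteq> {1..n}" "set ys \<subseteq> {1..n}"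
  shows "\<exists>is. set is \<subseteq> {1..<n} \<and> map (rho_perm is) xs = ys"
  using assms
proof (induction xs ys rule: list_induct2)
  case Nil
  then show ?case by (intro exI[of _ "[]"]) simp
next
  case (Cons x xs y ys)
  then obtain js where js: "set js \<subseteq> {1..<n}" "map (rho_perm js) xs = ys" by auto
  let ?z = "rho_perm js x"
  have "?z \<in> {1..n}" using rho_perm_mem[OF js(1)] Cons.prems by auto
  then obtain ks where ks: "set ks \<subseteq> {1..<n}" "rho_perm ks = transpose ?z y"
    using rho_perm_transpose[of ?z n y] Cons.prems by auto
  have "inj (rho_perm js)" using bij_word_perm bij_is_inj by blast
  then have "?z \<notin> set ys" using Cons.prems js(2) by (auto dest: injD)
  then have "map (transpose ?z y) ys = ys"
    using Cons.prems by (intro map_idI) (auto simp: transpose_def)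
  then have "map (rho_perm (ks @ js)) (x # xs) = y # ys"
    using js(2) ks(2) by (auto simp: word_perm_append)
  then show ?case using js(1) ks(1) by (intro exI[of _ "ks @ js"]) auto
qed

lemma rho_perm_rev: "rho_perm is (rho_perm (rev is) k) = k"
  by (induction "is" arbitrary: k) (simp_all add: word_perm_append)

section \<open>The defining relations in the group\<close>

locale uvb = fixes n :: nat
begin

sublocale group "UVB n"
  by (rule group_UVB)

abbreviation mul (infixl "\<cdot>" 70) where "g \<cdot> h \<equiv> g \<otimes>\<^bsub>UVB n\<^esub> h"
abbreviation unit ("\<e>") where "\<e> \<equiv> \<one>\<^bsub>UVB n\<^esub>"

text \<open>
  A total version of \<open>uvb_class\<close>: with the unit as default value, generators with an index out
  of range lie in the group too, and the relations between distant generators hold for all indices.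
\<close>

definition cls :: "uvb_gen word \<Rightarrow> uvb_gen word set"
  where "cls w = (if w \<in> words (uvb_gens n) then uvb_class n w else \<e>)"

lemma cls_closed [simp]: "cls w \<in> carrier (UVB n)"
  by (simp add: cls_def uvb_class_def UVB_def presented_group_class_in_carrier
      presented_group_one)

lemma cls_Nil [simp]: "cls [] = \<e>"
  by (simp add: cls_def uvb_class_def UVB_def presented_group_one)

lemma cls_append:
  "v \<in> words (uvb_gens n) \<Longrightarrow> w \<in> words (uvb_gens n) \<Longrightarrow> cls (v @ w) = cls v \<cdot> cls w"
  by (simp add: cls_def uvb_class_def UVB_def presented_group_mult_class)

lemma cls_Cons:
  "fst x \<in> uvb_gens n \<Longrightarrow> w \<in> words (uvb_gens n) \<Longrightarrow> cls (x # w) = cls [x] \<cdot> cls w"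
  using cls_append[of "[x]" w] by (cases x) simp

lemma cls_eq_iff:
  assumes "v \<in> words (uvb_gens n)" "w \<in> words (uvb_gens n)"
  shows "cls v = cls w \<longleftrightarrow> word_equiv (uvb_gens n) (uvb_rels n) v w"
  using assms eq_equiv_class_iff[OF equiv_word_rel, of v "uvb_gens n" w "uvb_rels n"]
  by (simp add: cls_def uvb_class_def word_rel_def)

lemma cls_rel:
  assumes "(v, w) \<in> uvb_rels n" "v \<in> words (uvb_gens n)" "w \<in> words (uvb_gens n)"
  shows "cls v = cls w"
  using assms word_equiv.relator[of "[]" "uvb_gens n" "[]" v w "uvb_rels n"]
  by (simp add: cls_eq_iff)

lemma cls_inverse:
  assumes "x \<in> uvb_gens n"
  shows "cls [(x, False)] = inv\<^bsub>UVB n\<^esub> cls [(x, True)]"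
proof -
  have "cls ([(x, False)] @ [(x, True)]) = \<e>"
    using assms cls_eq_iff[of "[(x, False), (x, True)]" "[]"]
      word_equiv.cancel[of "[]" "uvb_gens n" "[]" x "uvb_rels n" False] by simp
  then show ?thesis
    using assms by (subst (asm) cls_append) (simp_all add: inv_equality)
qed

definition s :: "nat \<Rightarrow> uvb_gen word set" where "s i = cls (sg i)"
definition r :: "nat \<Rightarrow> uvb_gen word set" where "r i = cls (rh i)"

lemma s_closed [simp]: "s i \<in> carrier (UVB n)" and r_closed [simp]: "r i \<in> carrier (UVB n)"
  by (simp_all add: s_def r_def)

lemma mem_uvb_gens [simp]:
  "Sigma_gen i \<in> uvb_gens n \<longleftrightarrow> 1 \<le> i \<and> i < n"
  "Rho_gen i \<in> uvb_gens n \<longleftrightarrow> 1 \<le> i \<and> i < n"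
  by (auto simp: uvb_gens_def)

lemma gen_out_of_range:
  "\<not> (1 \<le> i \<and> i < n) \<Longrightarrow> s i = \<e>" "\<not> (1 \<le> i \<and> i < n) \<Longrightarrow> r i = \<e>"
  by (auto simp: s_def r_def cls_def)

lemma r_r [simp]: "r i \<cdot> r i = \<e>"
proof (cases "1 \<le> i \<and> i < n")
  case True
  have "(rh i @ rh i, []) \<in> uvb_rels n" using True by (simp add: uvb_rels_def)
  from cls_rel[OF this] True show ?thesis by (simp add: r_def cls_Cons[of _ "rh _"])
qed (simp add: gen_out_of_range)

lemma r_r_mul [simp]: "g \<in> carrier (UVB n) \<Longrightarrow> r i \<cdot> (r i \<cdot> g) = g"
  by (simp flip: m_assoc)

lemma far_commute:
  assumes "i + 1 < j \<or> j + 1 < i"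
  shows "s i \<cdot> s j = s j \<cdot> s i" and "r i \<cdot> r j = r j \<cdot> r i" and "s i \<cdot> r j = r j \<cdot> s i"
proof -
  have "s i \<cdot> s j = s j \<cdot> s i \<and> r i \<cdot> r j = r j \<cdot> r i \<and> s i \<cdot> r j = r j \<cdot> s i"
  proof (cases "1 \<le> i \<and> i < n \<and> 1 \<le> j \<and> j < n")
    case True
    have "(sg i @ sg j, sg j @ sg i) \<in> uvb_rels n" "(rh i @ rh j, rh j @ rh i) \<in> uvb_rels n"
      "(sg i @ rh j, rh j @ sg i) \<in> uvb_rels n"
      using True assms by (simp_all add: uvb_rels_def)
    from this[THEN cls_rel] True show ?thesis
      by (simp add: s_def r_def cls_Cons[of _ "[_]"])
  next
    case False
    then have "s i = \<e> \<and> r i = \<e> \<or> s j = \<e> \<and> r j = \<e>"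
      using gen_out_of_range by blast
    then show ?thesis by auto
  qed
  then show "s i \<cdot> s j = s j \<cdot> s i" "r i \<cdot> r j = r j \<cdot> r i" "s i \<cdot> r j = r j \<cdot> s i" by auto
qed

lemma braid_relations:
  assumes "1 \<le> i" "i + 1 < n"
  shows "s i \<cdot> (s (i+1) \<cdot> s i) = s (i+1) \<cdot> (s i \<cdot> s (i+1))"
    and "r i \<cdot> (r (i+1) \<cdot> r i) = r (i+1) \<cdot> (r i \<cdot> r (i+1))"
    and "s i \<cdot> (r (i+1) \<cdot> r i) = r (i+1) \<cdot> (r i \<cdot> s (i+1))"
    and "r i \<cdot> (s (i+1) \<cdot> s i) = s (i+1) \<cdot> (s i \<cdot> r (i+1))"
    and "r (i+1) \<cdot> (s i \<cdot> s (i+1)) = s i \<cdot> (s (i+1) \<cdot> r i)"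
proof -
  have "(sg i @ sg (i+1) @ sg i, sg (i+1) @ sg i @ sg (i+1)) \<in> uvb_rels n"
    "(rh i @ rh (i+1) @ rh i, rh (i+1) @ rh i @ rh (i+1)) \<in> uvb_rels n"
    "(sg i @ rh (i+1) @ rh i, rh (i+1) @ rh i @ sg (i+1)) \<in> uvb_rels n"
    "(rh i @ sg (i+1) @ sg i, sg (i+1) @ sg i @ rh (i+1)) \<in> uvb_rels n"
    "(rh (i+1) @ sg i @ sg (i+1), sg i @ sg (i+1) @ rh i) \<in> uvb_rels n"
    using assms by (simp_all add: uvb_rels_def)
  from this[THEN cls_rel] assms show
    "s i \<cdot> (s (i+1) \<cdot> s i) = s (i+1) \<cdot> (s i \<cdot> s (i+1))"
    "r i \<cdot> (r (i+1) \<cdot> r i) = r (i+1) \<cdot> (r i \<cdot> r (i+1))"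
    "s i \<cdot> (r (i+1) \<cdot> r i) = r (i+1) \<cdot> (r i \<cdot> s (i+1))"
    "r i \<cdot> (s (i+1) \<cdot> s i) = s (i+1) \<cdot> (s i \<cdot> r (i+1))"
    "r (i+1) \<cdot> (s i \<cdot> s (i+1)) = s i \<cdot> (s (i+1) \<cdot> r i)"
    by (simp_all add: s_def r_def cls_Cons[of _ "_ # _"])
qed

section \<open>The symmetric group inside the unrestricted virtual braid group\<close>

fun R :: "nat list \<Rightarrow> uvb_gen word set" where
  "R [] = \<e>"
| "R (i # is) = r i \<cdot> R is"

lemma R_closed [simp]: "R is \<in> carrier (UVB n)"
  by (induction "is") simp_all

lemma R_append: "R (is @ js) = R is \<cdot> R js"
  by (induction "is") (simp_all add: m_assoc)

lemma R_rev: "R (rev is) \<cdot> R is = \<e>"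
  by (induction "is") (simp_all add: R_append m_assoc)

lemma inv_R: "inv\<^bsub>UVB n\<^esub> R is = R (rev is)"
  by (rule inv_equality) (simp_all add: R_rev)

lemma rho_word_words: "set is \<subseteq> {1..<n} \<Longrightarrow> rho_word is \<in> words (uvb_gens n)"
  by (force simp: words_def)

lemma R_cls: "set is \<subseteq> {1..<n} \<Longrightarrow> R is = cls (rho_word is)"
  by (induction "is") (simp_all add: r_def cls_Cons[of _ "rho_word _"] rho_word_words)

lemma R_commute:
  "(\<And>i. i \<in> set is \<Longrightarrow> r i \<cdot> g = g \<cdot> r i) \<Longrightarrow> g \<in> carrier (UVB n) \<Longrightarrow> R is \<cdot> g = g \<cdot> R is"
  by (induction "is") (simp_all add: m_assoc, simp flip: m_assoc)

lemma R_eq_imp_rho_perm_eq: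
  assumes "R is = R js" "set is \<subseteq> {1..<n}" "set js \<subseteq> {1..<n}"
  shows "rho_perm is = rho_perm js"
  using assms by (simp add: R_cls cls_eq_iff rho_word_words word_perm_equiv)

text \<open>
  Sliding a crossing through a run of consecutive crossings raises its index by one, by a single use
  of the braid relation.
\<close>

lemma R_run_shift:
  assumes "1 \<le> m" "m \<le> j" "j + 1 < k" "k \<le> n"
  shows "R [m..<k] \<cdot> r j = r (j+1) \<cdot> R [m..<k]"
proof -
  have split: "[m..<k] = [m..<j] @ [j, j+1] @ [j+2..<k]"
    using assms upt_add_eq_append[of m j "k - j"] by (simp add: upt_conv_Cons)
  have "R [m..<k] \<cdot> r j = R [m..<j] \<cdot> (r j \<cdot> (r (j+1) \<cdot> (R [j+2..<k] \<cdot> r j)))"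
    by (simp add: split R_append m_assoc)
  also have "R [j+2..<k] \<cdot> r j = r j \<cdot> R [j+2..<k]"
    by (rule R_commute) (simp_all add: far_commute)
  also have "r j \<cdot> (r (j+1) \<cdot> (r j \<cdot> R [j+2..<k])) = r (j+1) \<cdot> (r j \<cdot> (r (j+1) \<cdot> R [j+2..<k]))"
    using braid_relations(2)[of j] assms by (simp flip: m_assoc)
  also have "R [m..<j] \<cdot> \<dots> = r (j+1) \<cdot> (R [m..<j] \<cdot> (r j \<cdot> (r (j+1) \<cdot> R [j+2..<k])))"
    using R_commute[of "[m..<j]" "r (j+1)"] far_commute(2)
    by (simp flip: m_assoc)
  also have "\<dots> = r (j+1) \<cdot> R [m..<k]"
    by (simp add: split R_append m_assoc)
  finally show ?thesis .
qed

text \<open>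
  The runs \<open>\<rho>\<^sub>m \<cdots> \<rho>\<^sub>k\<^sub>-\<^sub>1\<close> represent all cosets of the subgroup generated by the
  \<open>\<rho>\<^sub>i\<close> with \<open>i > m\<close>, because this set of cosets is closed under right multiplication by each
  generator. There are as many runs as there are possible preimages of \<open>m\<close>.
\<close>

lemma R_coset_form:
  assumes "1 \<le> m" "m \<le> n" "set is \<subseteq> {m..<n}"
  shows "\<exists>js k. set js \<subseteq> {m+1..<n} \<and> m \<le> k \<and> k \<le> n \<and> R is = R js \<cdot> R [m..<k]"
  using assms(3)
proof (induction "is" rule: rev_induct)
  case Nil
  then show ?case using assms by (intro exI[of _ "[]"] exI[of _ m]) simp
next
  case (snoc j "is")
  then obtain js k where js: "set js \<subseteq> {m+1..<n}" "m \<le> k" "k \<le> n" "R is = R js \<cdot> R [m..<k]"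
    by auto
  have j: "m \<le> j" "j < n" using snoc.prems by auto
  have R: "R (is @ [j]) = R js \<cdot> (R [m..<k] \<cdot> r j)"
    using js(4) by (simp add: R_append m_assoc)
  consider "k < j" | "j = k" | "k = j + 1" | "j + 1 < k" by linarith
  then show ?case
  proof cases
    case 1
    then have "R [m..<k] \<cdot> r j = r j \<cdot> R [m..<k]"
      by (intro R_commute) (simp_all add: far_commute)
    then have "R (is @ [j]) = R (js @ [j]) \<cdot> R [m..<k]"
      using R by (simp add: R_append m_assoc)
    then show ?thesis using js 1 j by (intro exI[of _ "js @ [j]"] exI[of _ k]) auto
  next
    case 2
    then have "R (is @ [j]) = R js \<cdot> R [m..<k+1]"
      using R js(2) by (simp add: R_append)
    then show ?thesis using js 2 j by (intro exI[of _ js] exI[of _ "k+1"]) auto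
  next
    case 3
    then have "R (is @ [j]) = R js \<cdot> R [m..<j]"
      using R j by (simp add: R_append m_assoc)
    then show ?thesis using js 3 j by (intro exI[of _ js] exI[of _ j]) auto
  next
    case 4
    then have "R (is @ [j]) = R (js @ [j+1]) \<cdot> R [m..<k]"
      using R R_run_shift[of m j k] j js assms by (simp add: R_append m_assoc)
    then show ?thesis using js 4 j by (intro exI[of _ "js @ [j+1]"] exI[of _ k]) auto
  qed
qed

text \<open>
  In the coset form the run moves \<open>k\<close> to \<open>m\<close> while the other factor fixes \<open>m\<close>. So an
  element whose permutation fixes \<open>m\<close> has an empty run.
\<close>

lemma R_stabiliser:
  assumes "1 \<le> m" "m \<le> n" "set is \<subseteq> {m..<n}" "rho_perm is m = m"
  shows "\<exists>js. set js \<subseteq> {m+1..<n} \<and> R is = R js"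
proof -
  obtain js k where js: "set js \<subseteq> {m+1..<n}" "m \<le> k" "k \<le> n" "R is = R (js @ [m..<k])"
    using R_coset_form[OF assms(1-3)] by (auto simp: R_append)
  have "rho_perm is = rho_perm (js @ [m..<k])"
    using js assms by (intro R_eq_imp_rho_perm_eq) auto
  then have "rho_perm is k = rho_perm js m"
    using js(2) by (simp add: word_perm_append rho_perm_upt)
  also have "\<dots> = m" using js(1) by (intro rho_perm_fixes) auto
  finally have "k = m"
    using assms(4) bij_is_inj[OF bij_word_perm] by (metis injD)
  then show ?thesis using js by auto
qed

text \<open>
  The relations of the \<open>\<rho>\<^sub>i\<close> present the symmetric group: remove the smallest index over and
  over again with \<open>R_stabiliser\<close>.
\<close>

lemma R_faithful:
  assumes "set is \<subseteq> {1..<n}" "rho_perm is = id"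
  shows "R is = \<e>"
proof -
  have "R is = \<e>" if "1 \<le> m" "set is \<subseteq> {m..<n}" "rho_perm is = id" for m "is"
    using that
  proof (induction "n - m" arbitrary: m "is")
    case 0
    then show ?case by simp
  next
    case (Suc d)
    then obtain js where js: "set js \<subseteq> {m+1..<n}" "R is = R js"
      using R_stabiliser[of m "is"] by force
    then have "rho_perm js = id"
      using Suc.prems R_eq_imp_rho_perm_eq[of "is" js] by force
    then show ?case using Suc.hyps(1)[of "m+1" js] Suc.hyps(2) js by simp
  qed
  then show ?thesis using assms by blast
qed

section \<open>Pure generators\<close>

lemma inv_r [simp]: "inv\<^bsub>UVB n\<^esub> r i = r i"
  by (simp add: inv_equality)

text \<open>
  The arrow from \<open>p\<close> to \<open>q\<close>, as a conjugate of the first one by any element of the symmetric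
  group that takes \<open>1\<close> to \<open>p\<close> and \<open>2\<close> to \<open>q\<close>.
\<close>

definition arrow_elem :: "nat \<Rightarrow> nat \<Rightarrow> uvb_gen word set"
  where "arrow_elem p q = conjugate
    (R (SOME is. set is \<subseteq> {1..<n} \<and> rho_perm is 1 = p \<and> rho_perm is 2 = q)) (s 1 \<cdot> r 1)"

lemma arrow_elem_closed [simp]: "arrow_elem p q \<in> carrier (UVB n)"
  by (simp add: arrow_elem_def)

text \<open>
  Two choices of the conjugating element differ by an element that fixes \<open>1\<close> and \<open>2\<close>. Such
  an element is a product of \<open>\<rho>\<^sub>i\<close> with \<open>i \<ge> 3\<close>, and these commute with \<open>\<sigma>\<^sub>1\<close> and
  \<open>\<rho>\<^sub>1\<close>.
\<close>

lemma conjugate_R_s1_r1_eq: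
  assumes "2 \<le> n" "set is \<subseteq> {1..<n}" "set js \<subseteq> {1..<n}"
    and "rho_perm is 1 = rho_perm js 1" "rho_perm is 2 = rho_perm js 2"
  shows "conjugate (R is) (s 1 \<cdot> r 1) = conjugate (R js) (s 1 \<cdot> r 1)"
proof -
  let ?ks = "rev js @ is"
  have undo: "rho_perm (rev js) (rho_perm js k) = k" for k
    using rho_perm_rev[of "rev js" k] by simp
  have fixed: "rho_perm ?ks 1 = 1" "rho_perm ?ks 2 = 2"
    using assms(4,5) by (simp_all add: word_perm_append undo)
  have ks: "set ?ks \<subseteq> {1..<n}" using assms(2,3) by auto
  obtain ls where ls: "set ls \<subseteq> {1+1..<n}" "R ?ks = R ls"
    using R_stabiliser[OF _ _ ks fixed(1)] assms(1) by auto
  have "rho_perm ls 2 = 2"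
    using R_eq_imp_rho_perm_eq[OF ls(2) ks] ls(1) fixed(2) by force
  then obtain ms where ms: "set ms \<subseteq> {2+1..<n}" "R ls = R ms"
    using R_stabiliser[of 2 ls] ls(1) assms(1) by (auto simp: numeral_2_eq_2)
  have "r i \<cdot> (s 1 \<cdot> r 1) = s 1 \<cdot> r 1 \<cdot> r i" if "i \<in> set ms" for i
  proof -
    have "1 + 1 < i" using ms(1) that by auto
    then have c: "s 1 \<cdot> r i = r i \<cdot> s 1" "r 1 \<cdot> r i = r i \<cdot> r 1"
      using far_commute[of 1 i] by auto
    have "r i \<cdot> (s 1 \<cdot> r 1) = s 1 \<cdot> r i \<cdot> r 1" by (simp only: c(1)) (simp add: m_assoc)
    also have "\<dots> = s 1 \<cdot> (r 1 \<cdot> r i)" by (simp only: c(2)) (simp add: m_assoc)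
    finally show ?thesis by (simp add: m_assoc)
  qed
  then have "conjugate (R ms) (s 1 \<cdot> r 1) = s 1 \<cdot> r 1"
    by (intro conjugate_commute R_commute) auto
  moreover have "R is = R js \<cdot> R ms"
  proof -
    have "R ms = inv\<^bsub>UVB n\<^esub> R js \<cdot> R is"
      using ls(2) ms(2) by (simp add: R_append inv_R)
    then show ?thesis by simp
  qed
  ultimately show ?thesis by (simp flip: conjugate_conjugate)
qed

lemma arrow_elem_rho_perm:
  assumes "2 \<le> n" "set is \<subseteq> {1..<n}"
  shows "arrow_elem (rho_perm is 1) (rho_perm is 2) = conjugate (R is) (s 1 \<cdot> r 1)"
proof -
  let ?P = "\<lambda>js. set js \<subseteq> {1..<n} \<and> rho_perm js 1 = rho_perm is 1 \<and> rho_perm js 2 = rho_perm is 2"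
  have "?P (SOME js. ?P js)" using assms(2) by (intro someI[of ?P "is"]) simp
  then show ?thesis
    unfolding arrow_elem_def using assms by (intro conjugate_R_s1_r1_eq) auto
qed

lemma conjugate_arrow_elem:
  assumes "p \<in> {1..n}" "q \<in> {1..n}" "p \<noteq> q" "set is \<subseteq> {1..<n}"
  shows "conjugate (R is) (arrow_elem p q) = arrow_elem (rho_perm is p) (rho_perm is q)"
proof -
  have n: "2 \<le> n" using assms by auto
  obtain js where js: "set js \<subseteq> {1..<n}" "rho_perm js 1 = p" "rho_perm js 2 = q"
    using rho_perm_transitive[of "[1,2]" "[p,q]" n] assms n by auto
  have "conjugate (R is) (arrow_elem p q) = conjugate (R (is @ js)) (s 1 \<cdot> r 1)"
    using arrow_elem_rho_perm[OF n js(1)] js by (simp add: conjugate_conjugate R_append)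
  also have "\<dots> = arrow_elem (rho_perm (is @ js) 1) (rho_perm (is @ js) 2)"
    using js assms by (intro arrow_elem_rho_perm[symmetric] n) auto
  finally show ?thesis using js by (simp add: word_perm_append)
qed

text \<open>
  The mixed relation \<open>\<sigma>\<^sub>i\<rho>\<^sub>i\<^sub>+\<^sub>1\<rho>\<^sub>i = \<rho>\<^sub>i\<^sub>+\<^sub>1\<rho>\<^sub>i\<sigma>\<^sub>i\<^sub>+\<^sub>1\<close> and the braid relation for the
  \<open>\<rho>\<close>'s say that \<open>\<rho>\<^sub>i\<rho>\<^sub>i\<^sub>+\<^sub>1\<close> conjugates \<open>\<sigma>\<^sub>i\<rho>\<^sub>i\<close> to
  \<open>\<sigma>\<^sub>i\<^sub>+\<^sub>1\<rho>\<^sub>i\<^sub>+\<^sub>1\<close>.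
\<close>

lemma arrow_elem_Suc:
  assumes "1 \<le> i" "i < n"
  shows "arrow_elem i (i + 1) = s i \<cdot> r i"
  using assms
proof (induction i rule: nat_induct_at_least)
  case base
  then show ?case using arrow_elem_rho_perm[of "[]"] by (simp add: numeral_2_eq_2)
next
  case (Suc i)
  have img: "rho_perm [i, i + 1] i = i + 1" "rho_perm [i, i + 1] (i + 1) = i + 2"
    by (auto simp: transpose_def)
  have "arrow_elem (i + 1) (i + 2) = conjugate (R [i, i + 1]) (s i \<cdot> r i)"
    using conjugate_arrow_elem[of i "i + 1" "[i, i + 1]"] Suc img by simp
  also have "\<dots> = r i \<cdot> (r (i+1) \<cdot> (s i \<cdot> (r i \<cdot> (r (i+1) \<cdot> r i))))"
    by (simp add: conjugate_def inv_mult_group m_assoc)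
  also have "\<dots> = r i \<cdot> (r (i+1) \<cdot> ((s i \<cdot> (r (i+1) \<cdot> r i)) \<cdot> r (i+1)))"
    using Suc by (simp only: braid_relations(2) m_assoc s_closed r_closed m_closed)
  also have "\<dots> = s (i+1) \<cdot> r (i+1)"
    using Suc by (simp only: braid_relations(3)) (simp add: m_assoc)
  finally show ?case by simp
qed

definition commuting :: "nat \<times> nat \<Rightarrow> nat \<times> nat \<Rightarrow> bool"
  where "commuting = (\<lambda>(p, q) (k, l). arrow_elem p q \<cdot> arrow_elem k l = arrow_elem k l \<cdot> arrow_elem p q)"

lemma commuting_sym: "commuting a b \<Longrightarrow> commuting b a"
  by (auto simp: commuting_def split: prod.splits)

lemma commuting_transport:
  assumes "commuting (a, b) (c, d)" "a \<noteq> b" "c \<noteq> d" "{a, b, c, d} \<subseteq> {1..n}"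
    and "set is \<subseteq> {1..<n}"
  shows "commuting (rho_perm is a, rho_perm is b) (rho_perm is c, rho_perm is d)"
proof -
  have "conjugate (R is) (arrow_elem a b \<cdot> arrow_elem c d)
      = conjugate (R is) (arrow_elem c d \<cdot> arrow_elem a b)"
    using assms(1) by (simp add: commuting_def)
  then show ?thesis
    using assms(2-) by (simp add: conjugate_mult conjugate_arrow_elem commuting_def)
qed

text \<open>
  Up to the action of the symmetric group, two arrows over different pairs with a common strand have a
  common source, a common target, or form a path; the strands \<open>1, 2, 3\<close> show all three cases.
\<close>

lemma commuting_three:
  assumes "distinct [p, q, k]" "{p, q, k} \<subseteq> {1..n}"
  shows "commuting (p, q) (p, k)" "commuting (p, k) (q, k)" "commuting (p, q) (q, k)"
proof -
  have n: "3 \<le> n" using card_mono[OF _ assms(2)] assms(1) by simp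
  obtain js where js: "set js \<subseteq> {1..<n}" "map (rho_perm js) [1, 2, 3] = [p, q, k]"
    using rho_perm_transitive[of "[1,2,3]" "[p,q,k]" n] assms n by auto
  have l: "arrow_elem 1 2 = s 1 \<cdot> r 1" "arrow_elem 2 3 = s 2 \<cdot> r 2"
    using arrow_elem_Suc[of 1] arrow_elem_Suc[of 2] n by (simp_all add: numeral_eq_Suc)
  have "rho_perm [2] 1 = 1" "rho_perm [2] 2 = 3" by simp_all
  then have "arrow_elem 1 3 = conjugate (R [2]) (arrow_elem 1 2)"
    using conjugate_arrow_elem[of 1 2 "[2]"] n by simp
  then have l': "arrow_elem 1 3 = r 2 \<cdot> (s 1 \<cdot> (r 1 \<cdot> r 2))"
    unfolding l by (simp add: conjugate_def m_assoc)
  have "(1::nat) + 1 = 2" by simp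
  note rel = braid_relations[of 1, unfolded this]
  note comm = three_strands_commute[of "s 1" "s 2" "r 1" "r 2"]
  have "commuting (1, 2) (1, 3)" "commuting (1, 3) (2, 3)" "commuting (1, 2) (2, 3)"
    unfolding commuting_def prod.case l l' using n by (intro comm rel; simp)+
  then show "commuting (p, q) (p, k)" "commuting (p, k) (q, k)" "commuting (p, q) (q, k)"
    using commuting_transport[OF _ _ _ _ js(1)] js(2) n by fastforce+
qed

lemma commuting_four:
  assumes "distinct [p, q, k, l]" "{p, q, k, l} \<subseteq> {1..n}"
  shows "commuting (p, q) (k, l)"
proof -
  have n: "4 \<le> n" using card_mono[OF _ assms(2)] assms(1) by simp
  obtain js where js: "set js \<subseteq> {1..<n}" "map (rho_perm js) [1, 2, 3, 4] = [p, q, k, l]"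
    using rho_perm_transitive[of "[1,2,3,4]" "[p,q,k,l]" n] assms n by auto
  have l: "arrow_elem 1 2 = s 1 \<cdot> r 1" "arrow_elem 3 4 = s 3 \<cdot> r 3"
    using arrow_elem_Suc[of 1] arrow_elem_Suc[of 3] n by (simp_all add: numeral_eq_Suc)
  have c: "s 1 \<cdot> s 3 = s 3 \<cdot> s 1" "s 1 \<cdot> r 3 = r 3 \<cdot> s 1" "s 3 \<cdot> r 1 = r 1 \<cdot> s 3"
    "r 1 \<cdot> r 3 = r 3 \<cdot> r 1"
    using far_commute[of 1 3] far_commute[of 3 1] by simp_all
  have "s 1 \<cdot> r 1 \<cdot> (s 3 \<cdot> r 3) = s 1 \<cdot> (r 1 \<cdot> s 3) \<cdot> r 3" by (simp add: m_assoc)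
  also have "\<dots> = s 1 \<cdot> (s 3 \<cdot> r 1) \<cdot> r 3" by (simp only: c(3))
  also have "\<dots> = (s 1 \<cdot> s 3) \<cdot> (r 1 \<cdot> r 3)" by (simp add: m_assoc)
  also have "\<dots> = (s 3 \<cdot> s 1) \<cdot> (r 3 \<cdot> r 1)" by (simp only: c(1,4))
  also have "\<dots> = s 3 \<cdot> (s 1 \<cdot> r 3) \<cdot> r 1" by (simp add: m_assoc)
  also have "\<dots> = s 3 \<cdot> (r 3 \<cdot> s 1) \<cdot> r 1" by (simp only: c(2))
  also have "\<dots> = s 3 \<cdot> r 3 \<cdot> (s 1 \<cdot> r 1)" by (simp add: m_assoc)
  finally have "commuting (1, 2) (3, 4)" unfolding commuting_def prod.case l .
  then show ?thesis
    using commuting_transport[OF _ _ _ _ js(1)] js(2) n by fastforce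
qed

section \<open>Factorisation into arrows and a permutation\<close>

definition arrow_val :: "arrow \<times> bool \<Rightarrow> uvb_gen word set"
  where "arrow_val x = (let g = arrow_elem (fst (fst x)) (snd (fst x))
    in if snd x then g else inv\<^bsub>UVB n\<^esub> g)"

text \<open>
  The letters that denote an arrow of the group; on other letters \<open>arrow_val\<close> has no meaning.
\<close>

definition arrow_ok :: "arrow \<times> bool \<Rightarrow> bool"
  where "arrow_ok x \<longleftrightarrow> ends x \<subseteq> {1..n} \<and> fst (fst x) \<noteq> snd (fst x)"

fun arrow_prod :: "arrow word \<Rightarrow> uvb_gen word set" where
  "arrow_prod [] = \<e>"
| "arrow_prod (x # w) = arrow_val x \<cdot> arrow_prod w"

lemma arrow_val_closed [simp]: "arrow_val x \<in> carrier (UVB n)"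
  by (simp add: arrow_val_def Let_def)

lemma arrow_prod_closed [simp]: "arrow_prod w \<in> carrier (UVB n)"
  by (induction w) simp_all

lemma arrow_prod_append: "arrow_prod (v @ w) = arrow_prod v \<cdot> arrow_prod w"
  by (induction v) (simp_all add: m_assoc)

lemma arrow_val_inv_letter: "arrow_val (inv_letter x) = inv\<^bsub>UVB n\<^esub> arrow_val x"
  by (simp add: arrow_val_def inv_letter_def Let_def)

lemma arrow_elem_commute:
  assumes "{p, q} \<subseteq> {1..n}" "p \<noteq> q" "{k, l} \<subseteq> {1..n}" "k \<noteq> l" "{p, q} \<noteq> {k, l}"
  shows "arrow_elem p q \<cdot> arrow_elem k l = arrow_elem k l \<cdot> arrow_elem p q"
proof -
  consider "k = p" "distinct [p, q, l]" | "l = q" "distinct [p, k, q]"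
    | "k = q" "distinct [p, q, l]" | "l = p" "distinct [k, p, q]" | "distinct [p, q, k, l]"
    using assms by fastforce
  then have "commuting (p, q) (k, l)"
  proof cases
    case 1
    then show ?thesis using assms commuting_three(1)[of p q l] by simp
  next
    case 2
    then show ?thesis using assms commuting_three(2)[of p k q] by simp
  next
    case 3
    then show ?thesis using assms commuting_three(3)[of p q l] by simp
  next
    case 4
    then show ?thesis using assms commuting_sym[OF commuting_three(3)[of k p q]] by simp
  next
    case 5
    then show ?thesis using assms commuting_four by simp
  qed
  then show ?thesis by (simp add: commuting_def)
qed

lemma arrow_val_commute:
  assumes "arrow_ok x" "arrow_ok y" "ends x \<noteq> ends y"
  shows "arrow_val x \<cdot> arrow_val y = arrow_val y \<cdot> arrow_val x"
proof -
  let ?g = "arrow_elem (fst (fst x)) (snd (fst x))"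
  let ?h = "arrow_elem (fst (fst y)) (snd (fst y))"
  have gh: "?g \<cdot> ?h = ?h \<cdot> ?g"
    using assms by (intro arrow_elem_commute) (simp_all add: arrow_ok_def ends_def)
  then have *: "arrow_val x \<cdot> ?h = ?h \<cdot> arrow_val x"
    by (simp add: arrow_val_def Let_def commute_inv)
  show ?thesis
    using * commute_inv[of ?h "arrow_val x"] by (simp add: arrow_val_def[of y] Let_def)
qed

lemma conjugate_arrow_val:
  assumes "arrow_ok x" "set is \<subseteq> {1..<n}"
  shows "conjugate (R is) (arrow_val x) = arrow_val (relabel (rho_perm is) x)"
  using assms
  by (cases x) (auto simp: arrow_val_def arrow_ok_def ends_def relabel_def Let_def
      conjugate_inv conjugate_arrow_elem)

lemma conjugate_arrow_prod:
  assumes "\<forall>x\<in>set w. arrow_ok x" "set is \<subseteq> {1..<n}"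
  shows "conjugate (R is) (arrow_prod w) = arrow_prod (map (relabel (rho_perm is)) w)"
  using assms by (induction w) (simp_all add: conjugate_mult conjugate_arrow_val)

lemma arrow_ok_relabel:
  "arrow_ok x \<Longrightarrow> word_perm w permutes {1..n} \<Longrightarrow> arrow_ok (relabel (word_perm w) x)"
  using bij_is_inj[OF bij_word_perm[of w]]
  by (simp add: arrow_ok_def ends_def relabel_def permutes_in_image inj_eq del: atLeastAtMost_iff)

lemma arrow_ok_arrows: "w \<in> words (uvb_gens n) \<Longrightarrow> \<forall>x\<in>set (arrows w). arrow_ok x"
proof (induction w)
  case (Cons a w)
  obtain g b where a: "a = (g, b)" by force
  have "\<forall>x\<in>set (gen_arrows a). arrow_ok x"
    using Cons.prems a by (cases g) (auto simp: arrow_ok_def ends_def)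
  moreover have "word_perm [a] permutes {1..n}"
    using Cons.prems a by (intro word_perm_permutes) simp
  then have "\<forall>x\<in>set (arrows w). arrow_ok (relabel (gen_perm (fst a)) x)"
    using Cons a arrow_ok_relabel[of _ "[a]"] by simp
  ultimately show ?case by auto
qed simp

fun gen_index :: "uvb_gen \<Rightarrow> nat" where
  "gen_index (Sigma_gen i) = i"
| "gen_index (Rho_gen i) = i"

abbreviation indices :: "uvb_gen word \<Rightarrow> nat list"
  where "indices w \<equiv> map (\<lambda>x. gen_index (fst x)) w"

lemma word_perm_indices: "rho_perm (indices w) = word_perm w"
proof (induction w)
  case (Cons a w)
  then show ?case by (cases a; cases "fst a") simp_all
qed simp

lemma indices_range: "w \<in> words (uvb_gens n) \<Longrightarrow> set (indices w) \<subseteq> {1..<n}"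
  by (auto simp: words_def uvb_gens_def)

lemma cls_letter:
  assumes "fst x \<in> uvb_gens n"
  shows "cls [x] = arrow_prod (gen_arrows x) \<cdot> r (gen_index (fst x))"
proof -
  obtain g b where x: "x = (g, b)" by force
  show ?thesis
  proof (cases g)
    case (Sigma_gen i)
    then have i: "1 \<le> i" "i < n" using assms x by auto
    have e: "arrow_elem i (i + 1) = s i \<cdot> r i" using arrow_elem_Suc i by blast
    have e': "arrow_elem (i + 1) i = r i \<cdot> s i"
    proof -
      have "arrow_elem (i + 1) i = conjugate (R [i]) (arrow_elem i (i + 1))"
        using conjugate_arrow_elem[of i "i + 1" "[i]"] i by simp
      then show ?thesis unfolding e by (simp add: conjugate_def m_assoc)
    qed
    show ?thesis
    proof (cases b)
      case True
      then show ?thesis using e by (simp add: x Sigma_gen arrow_val_def s_def m_assoc)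
    next
      case False
      then have "cls [x] = inv\<^bsub>UVB n\<^esub> s i"
        using cls_inverse[of g] assms by (simp add: x Sigma_gen s_def)
      then show ?thesis using False e'
        by (simp add: x Sigma_gen arrow_val_def inv_mult_group m_assoc)
    qed
  next
    case (Rho_gen i)
    then show ?thesis
      using cls_inverse[of g] assms inv_r[of i] by (cases b) (simp_all add: x Rho_gen r_def)
  qed
qed

text \<open>
  The arrows of a word, read in the group, together with the word in which every
  \<open>\<sigma>\<^sub>i\<close> has become \<open>\<rho>\<^sub>i\<close>, recover the group element. This is the semidirect product
  decomposition.
\<close>

lemma cls_factorisation:
  "w \<in> words (uvb_gens n) \<Longrightarrow> cls w = arrow_prod (arrows w) \<cdot> R (indices w)"
proof (induction w)
  case (Cons a w)
  have a: "fst a \<in> uvb_gens n" "w \<in> words (uvb_gens n)" using Cons.prems by (cases a; simp)+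
  let ?i = "gen_index (fst a)"
  have i: "set [?i] \<subseteq> {1..<n}" using a(1) by (auto simp: uvb_gens_def)
  have p: "rho_perm [?i] = gen_perm (fst a)" by (cases "fst a") simp_all
  have conj: "conjugate (R [?i]) (arrow_prod (arrows w))
      = arrow_prod (map (relabel (gen_perm (fst a))) (arrows w))"
    using conjugate_arrow_prod[OF arrow_ok_arrows[OF a(2)] i] p by simp
  then have r: "r ?i \<cdot> arrow_prod (arrows w)
      = arrow_prod (map (relabel (gen_perm (fst a))) (arrows w)) \<cdot> r ?i"
    unfolding conj[symmetric] by (simp add: m_assoc conjugate_def)
  have "cls (a # w) = arrow_prod (gen_arrows a) \<cdot> r ?i \<cdot> (arrow_prod (arrows w) \<cdot> R (indices w))"
    using cls_Cons[OF a] cls_letter[OF a(1)] Cons.IH[OF a(2)] by simp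
  also have "\<dots> = arrow_prod (gen_arrows a) \<cdot> ((r ?i \<cdot> arrow_prod (arrows w)) \<cdot> R (indices w))"
    by (simp add: m_assoc)
  also have "\<dots> = arrow_prod (arrows (a # w)) \<cdot> R (indices (a # w))"
    by (simp add: r arrow_prod_append m_assoc)
  finally show ?case .
qed simp

lemma arrow_prod_commute:
  assumes "arrow_ok x" "\<forall>y\<in>set w. arrow_ok y \<and> ends y \<noteq> ends x"
  shows "arrow_val x \<cdot> arrow_prod w = arrow_prod w \<cdot> arrow_val x"
  using assms(2)
proof (induction w)
  case (Cons y w)
  have "arrow_val x \<cdot> arrow_val y = arrow_val y \<cdot> arrow_val x"
    using assms(1) Cons.prems by (intro arrow_val_commute) auto
  then have "arrow_val x \<cdot> arrow_prod (y # w) = arrow_val y \<cdot> (arrow_val x \<cdot> arrow_prod w)"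
    by (simp flip: m_assoc)
  then show ?case using Cons by (simp add: m_assoc)
qed simp

text \<open>
  The word problem in the product of the free groups, by induction on the length. The word over the
  pair of the first letter is non-empty and reduces to the empty word, so it contains two adjacent
  inverse letters. In \<open>w\<close> these are separated only by arrows over other pairs, with which they
  commute; hence they can be brought together and cancelled without changing the reductions.
\<close>

lemma arrow_prod_trivial:
  assumes "\<forall>x\<in>set w. arrow_ok x" "\<And>D. free_reduce (filter (\<lambda>x. ends x = D) w) = []"
  shows "arrow_prod w = \<e>"
  using assms
proof (induction w rule: length_induct)
  case (1 w)
  show ?case
  proof (cases w)
    case (Cons y w')
    let ?P = "\<lambda>x. ends x = ends y"
    have "filter ?P w \<noteq> []" using Cons by simp
    then have "\<not> reduced (filter ?P w)"
      using 1(3)[of "ends y"] free_reduce_reduced by metis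
    then obtain u x v where split: "filter ?P w = u @ x # inv_letter x # v"
      using not_reduced_split by blast
    obtain u1 u2 where u: "w = u1 @ u2" "filter ?P u1 = u" "filter ?P u2 = x # inv_letter x # v"
      using split by (rule filter_eq_appendE)
    obtain a b where ab: "u2 = a @ x # b" "\<forall>z\<in>set a. \<not> ?P z" "?P x"
        "filter ?P b = inv_letter x # v"
      using filter_eq_ConsD[OF u(3)] by metis
    obtain c d where cd: "b = c @ inv_letter x # d" "\<forall>z\<in>set c. \<not> ?P z"
      using filter_eq_ConsD[OF ab(4)] by metis
    let ?A = "u1 @ a"
    have w: "w = ?A @ x # c @ inv_letter x # d" using u(1) ab(1) cd(1) by simp
    \<comment> \<open>Everything between the two letters lies over other pairs.\<close>
    have "arrow_val x \<cdot> arrow_prod c = arrow_prod c \<cdot> arrow_val x"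
      using 1(2) cd(2) ab(3) by (intro arrow_prod_commute) (auto simp: w)
    then have "arrow_val x \<cdot> (arrow_prod c \<cdot> g) = arrow_prod c \<cdot> (arrow_val x \<cdot> g)"
      if "g \<in> carrier (UVB n)" for g
      using that by (simp flip: m_assoc)
    then have "arrow_prod w = arrow_prod (?A @ c @ d)"
      by (simp add: w arrow_prod_append arrow_val_inv_letter m_assoc)
    also have "\<dots> = \<e>"
    proof -
      have "free_reduce (filter (\<lambda>x. ends x = D) (?A @ c @ d)) = []" for D
      proof (cases "D = ends y")
        case True
        then have "filter (\<lambda>x. ends x = D) c = []" using cd(2) by simp
        moreover have "free_reduce (filter (\<lambda>x. ends x = D) w) = []" using 1(3) .
        moreover have "ends (inv_letter x) = ends x" by (simp add: ends_def inv_letter_def)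
        ultimately show ?thesis using True ab(3)
          using free_reduce_cancel[of "filter ?P u1 @ filter ?P a" x "filter ?P d"]
          by (simp add: w)
      next
        case False
        then have "ends x \<noteq> D" "ends (inv_letter x) \<noteq> D"
          using ab(3) by (auto simp: ends_def inv_letter_def)
        then show ?thesis using 1(3)[of D] by (simp add: w)
      qed
      moreover have "length (?A @ c @ d) < length w" by (simp add: w)
      moreover have "\<forall>x\<in>set (?A @ c @ d). arrow_ok x" using 1(2) by (auto simp: w)
      ultimately show ?thesis using 1(1) by blast
    qed
    finally show ?thesis .
  qed simp
qed

lemma cls_trivial:
  assumes "w \<in> words (uvb_gens n)" "word_perm w = id"
    "\<And>D. free_reduce (strand_word D w) = []"
  shows "cls w = \<e>"
proof -
  have "arrow_prod (arrows w) = \<e>"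
    by (rule arrow_prod_trivial)
      (use arrow_ok_arrows[OF assms(1)] assms(3) in \<open>simp_all only: strand_word_def\<close>)
  moreover have "R (indices w) = \<e>"
    by (rule R_faithful) (simp_all only: indices_range[OF assms(1)] word_perm_indices assms(2))
  ultimately show ?thesis using cls_factorisation[OF assms(1)] by simp
qed

section \<open>The centraliser\<close>

text \<open>
  A word for the arrow from \<open>p\<close> to \<open>q\<close>, which is a test element for the centraliser.
\<close>

lemma pure_word_exists:
  assumes "p \<in> {1..n}" "q \<in> {1..n}" "p \<noteq> q"
  shows "\<exists>v\<in>words (uvb_gens n). word_perm v = id \<and> arrows v = [((p, q), True)]"
proof -
  have n: "2 \<le> n" using assms by auto
  obtain js where js: "set js \<subseteq> {1..<n}" "map (rho_perm js) [1, 2] = [p, q]"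
    using rho_perm_transitive[of "[1,2]" "[p,q]" n] assms n by auto
  let ?v = "rho_word js @ (sg 1 @ rh 1) @ rho_word (rev js)"
  have none: "arrows (rho_word is) = []" for "is" by (induction "is") simp_all
  have "?v \<in> words (uvb_gens n)"
    using n js(1) rho_word_words[of js] rho_word_words[of "rev js"] by simp
  moreover have "word_perm ?v = id"
    using rho_perm_rev[of js] by (simp add: word_perm_append fun_eq_iff)
  moreover have "arrows ?v = [((p, q), True)]"
    using js(2) none[of js] none[of "rev js"] by (simp add: arrows_append relabel_def numeral_2_eq_2)
  ultimately show ?thesis by blast
qed

lemma centraliser_UVP_trivial:
  assumes g: "g \<in> centraliser (UVB n) (UVP n)"
  shows "g = \<e>"
proof -
  have gc: "g \<in> carrier (UVB n)" using g by (simp add: centraliser_def)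
  then obtain w where w: "w \<in> words (uvb_gens n)" "g = uvb_class n w"
    unfolding UVB_def uvb_class_def by (rule presented_group_classE)
  then have gw: "g = cls w" by (simp add: cls_def)
  let ?\<pi> = "word_perm w"
  have perm: "?\<pi> permutes {1..n}" using w(1) by (rule word_perm_permutes)
  \<comment> \<open>The invariants of \<open>g \<lambda>\<^sub>p\<^sub>q\<close> and \<open>\<lambda>\<^sub>p\<^sub>q g\<close>, compared over the pair \<open>D\<close>.\<close>
  have key: "free_reduce (strand_word D w @ filter (\<lambda>x. ends x = D) [((?\<pi> p, ?\<pi> q), True)])
      = free_reduce (filter (\<lambda>x. ends x = D) [((p, q), True)] @ strand_word D w)"
    if pq: "p \<in> {1..n}" "q \<in> {1..n}" "p \<noteq> q" for p q D
  proof -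
    obtain v where v: "v \<in> words (uvb_gens n)" "word_perm v = id" "arrows v = [((p, q), True)]"
      using pure_word_exists[OF pq] by blast
    have "cls v \<in> UVP n"
      using v uvb_phi_class[OF v(1)] cls_closed[of v]
      by (simp add: UVP_def kernel_def cls_def sym_group_one)
    then have "cls w \<cdot> cls v = cls v \<cdot> cls w"
      using g gw by (simp add: centraliser_def)
    then have "word_equiv (uvb_gens n) (uvb_rels n) (w @ v) (v @ w)"
      using w v by (simp flip: cls_append add: cls_eq_iff)
    from strand_word_equiv[OF this, of D] show ?thesis
      using v by (simp add: strand_word_def arrows_append relabel_Pair)
  qed
  \<comment> \<open>The exponent of the arrow from \<open>\<pi> p\<close> to \<open>\<pi> q\<close> is one larger than in \<open>g\<close> on the left
    of \<open>key\<close>, so this arrow must be the one that is prepended on the right.\<close>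
  have fixed: "?\<pi> p = p \<and> ?\<pi> q = q" if pq: "p \<in> {1..n}" "q \<in> {1..n}" "p \<noteq> q" for p q
  proof -
    let ?a = "(?\<pi> p, ?\<pi> q)" and ?D = "{?\<pi> p, ?\<pi> q}"
    have "exponent_sum ?a (strand_word ?D w) + 1
      = exponent_sum ?a (filter (\<lambda>x. ends x = ?D) [((p, q), True)]) + exponent_sum ?a (strand_word ?D w)"
      using arg_cong[OF key[OF pq, of ?D], of "exponent_sum ?a"]
      by (simp add: exponent_sum_free_reduce ends_def)
    then have "exponent_sum ?a (filter (\<lambda>x. ends x = ?D) [((p, q), True)]) = 1" by simp
    then show ?thesis by (auto split: if_splits)
  qed
  have "?\<pi> p = p" for p
  proof (cases "p \<in> {1..n}")
    case True
    show ?thesis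
    proof (cases "\<exists>q\<in>{1..n}. q \<noteq> p")
      case True
      then show ?thesis using fixed \<open>p \<in> {1..n}\<close> by blast
    next
      case False
      \<comment> \<open>Here \<open>p\<close> is the only strand.\<close>
      then show ?thesis using perm \<open>p \<in> {1..n}\<close> by (metis permutes_in_image)
    qed
  next
    case False
    then show ?thesis using perm by (simp add: permutes_def)
  qed
  then have id: "?\<pi> = id" by auto
  have "free_reduce (strand_word D w) = []" for D
  proof (cases "\<exists>p q. p \<in> {1..n} \<and> q \<in> {1..n} \<and> p \<noteq> q \<and> D = {p, q}")
    case True
    then obtain p q where pq: "p \<in> {1..n}" "q \<in> {1..n}" "p \<noteq> q" "D = {p, q}" by blast
    show ?thesis
    proof (rule free_reduce_central[of "(p, q)" "(q, p)"])
      show "(p, q) \<noteq> (q, p)" using pq by simp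
      show "free_reduce (strand_word D w @ [((p, q), True)]) = free_reduce (((p, q), True) # strand_word D w)"
        using key[of p q D] pq id by (simp add: ends_def)
      show "free_reduce (strand_word D w @ [((q, p), True)]) = free_reduce (((q, p), True) # strand_word D w)"
        using key[of q p D] pq id by (simp add: ends_def insert_commute)
    qed
  next
    case False
    then have "strand_word D w = []"
      using arrow_ok_arrows[OF w(1)]
      by (fastforce simp: strand_word_def filter_empty_conv arrow_ok_def ends_def)
    then show ?thesis by simp
  qed
  then show ?thesis using cls_trivial w(1) id gw by blast
qed

end

theorem proposition2p18:
  fixes n :: nat
  shows "centraliser (UVB n) (UVP n) = {\<one>\<^bsub>UVB n\<^esub>}"
proof -
  interpret uvb n .
  have "UVP n \<subseteq> carrier (UVB n)" by (auto simp: UVP_def kernel_def)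
  then have "\<one>\<^bsub>UVB n\<^esub> \<in> centraliser (UVB n) (UVP n)"
    by (auto simp: centraliser_def)
  then show ?thesis using centraliser_UVP_trivial by blast
qed

end
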